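(* Let $\{X^{(\boldsymbol n)}\}_{\boldsymbol n}$ be a matrix sequence such that $\{X^{(\boldsymbol n)}\}_{\boldsymbol n}\sim_\lambda\omega$, with $\omega:D\subset\mathbb R^M\to\mathbb R$. Suppose that $m(\{\boldsymbol y\in D:\omega(\boldsymbol y)=t\})=0$ for every $t\in R_\omega$ (equivalently, that $\phi_\omega$ is continuous). Then: (a) $\{X^{(\boldsymbol n)}\}_{\boldsymbol n}\sim_\lambda\omega^*(x)$, $x\in(0,1)$. (b) $\displaystyle\lim_{\boldsymbol n\to\infty}\frac{N(X^{(\boldsymbol n)},t)}{d_{\boldsymbol n}}=\phi_\omega(t)$ for every $t\in\mathbb R$. (c) Let $\hat k=\hat k(\boldsymbol n)\in\{1,\dots,d_{\boldsymbol n}\}$ be such that $\hat k(\boldsymbol n)/d_{\boldsymbol n}\to x_0^-$ (convergence to $x_0$ from the left) with $x_0\in(0,1)$, as $\boldsymbol n\to\infty$. Then $$\lim_{\boldsymbol n\to\infty}\lambda_{\hat k(\boldsymbol n)}(X^{(\boldsymbol n)})\in(\inf R_\omega,\sup R_\omega),\qquad \sup\Big\{t\in R_\omega: t\le\lim_{\boldsymbol n\to\infty}\lambda_{\hat k(\boldsymbol n)}(X^{(\boldsymbol n)})\Big\}=\lim_{x\to x_0^-}\omega^*(x).$$ (d) In particular, if $\omega^*$ is (left) continuous at $x_0$, then $$\lim_{\boldsymbol n\to\infty}\lambda_{\hat k(\boldsymbol n)}(X^{(\boldsymbol n)})=\lim_{\boldsymbol n\to\infty}\omega^*\!\left(\frac{\hat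 k(\boldsymbol n)}{d_{\boldsymbol n}}\right)=\omega^*(x_0).$$ (e) Finally, if $\lambda_{\hat k(\boldsymbol n)}(X^{(\boldsymbol n)})\ge\inf R_\omega$ for all sufficiently large $\boldsymbol n$ (respectively $\le\sup R_\omega$ for all sufficiently large $\boldsymbol n$), then the equalities in (d) hold also for $x_0=0$, i.e. when $\hat k(\boldsymbol n)/d_{\boldsymbol n}\to0$ (respectively for $x_0=1$, i.e. when $\hat k(\boldsymbol n)/d_{\boldsymbol n}\to1$).
   Context: For $\boldsymbol n=(n_1,\dots,n_d)\in\mathbb N^d$, $d_{\boldsymbol n}=\prod_j n_j$, and $\boldsymbol n\to\infty$ means $\min_j n_j\to\infty$. A matrix sequence $\{X^{(\boldsymbol n)}\}_{\boldsymbol n}$ consists of $d_{\boldsymbol n}\times d_{\boldsymbol n}$ matrices; all their eigenvalues are assumed real. $d^+_{\boldsymbol n}$ and $d^-_{\boldsymbol n}$ are the numbers (with multiplicity) of nonnegative and of negative eigenvalues of $X^{(\boldsymbol n)}$, and the eigenvalues are written $\lambda_{-d^-_{\boldsymbol n}}\le\dots\le\lambda_{-1}<0\le\lambda_1\le\dots\le\lambda_{d^+_{\boldsymbol n}}$. The re-indexing $\hat k\in\{1,\dots,d_{\boldsymbol n}\}$ of $k\in\{-d^-_{\boldsymbol n},\dots,d^+_{\boldsymbol n}\}\setminus\{0\}$ is $\hat k=k+d^-_{\boldsymbol n}+1$ if $k<0$, $\hat k=k+d^-_{\boldsymbol n}$ if $k>0$; thus $\lambda_{\hat k}(X^{(\boldsymbol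 n)})$ is the $\hat k$-th smallest among all $d_{\boldsymbol n}$ eigenvalues. $m$ is Lebesgue measure. Let $\omega:D\subset\mathbb R^M\to\mathbb R$ be Borel measurable, $D$ Borel with $0<m(D)<\infty$, such that $\int_D\omega\,dm$ exists, finite or infinite. $\{X^{(\boldsymbol n)}\}_{\boldsymbol n}\sim_\lambda\omega$ means $$\lim_{\boldsymbol n\to\infty}\frac1{d_{\boldsymbol n}}\sum_{k=-d^-_{\boldsymbol n},\,k\ne0}^{d^+_{\boldsymbol n}}F(\lambda_k(X^{(\boldsymbol n)}))=\frac1{m(D)}\int_D F(\omega(\boldsymbol y))\,m(d\boldsymbol y)\quad\forall F\in C_c(\mathbb R).$$ The essential range is $R_\omega=\{t\in\mathbb R: m(\{\boldsymbol y\in D:|\omega(\boldsymbol y)-t|<\epsilon\})>0\ \forall\epsilon>0\}$. Set $\phi_\omega(t)=\frac1{m(D)}m(\{\boldsymbol y\in D:\omega(\boldsymbol y)\le t\})$ for $t\in\mathbb R$. The monotone rearrangement is $\omega^*:(0,1)\to R_\omega$, $\omega^*(x)=\inf\{t\in R_\omega:\phi_\omega(t)>x\}$, extended to the endpoints by $\omega^*(0)=\lim_{x\to0^+}\omega^*(x)$, $\omega^*(1)=\lim_{x\to1^-}\omega^*(x)$. $N(X^{(\boldsymbol n)},t)$ is the number of indices $k$ with $\lambda_k(X^{(\boldsymbol n)})\le t$.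
   Formalization: In (c) the limit is not claimed to exist: eigenvalues eventually stay in a compact part of (inf R_ω, sup R_ω); for a limit L that exists, the formula holds unless L∈R_ω is not a limit of points of R_ω below L (with t<L it always holds). The "equivalently φ_ω continuous" remark is omitted. *)

theory Defs
  imports
    "HOL-Analysis.Analysis"
    "Jordan_Normal_Form.Char_Poly"
begin

section \<open>Multi-indices\<close>

text \<open>
  A multi-index in \<open>\<nat>\<^sup>d\<close> is a function on a finite index type, and \<open>n \<rightarrow> \<infinity>\<close> means that its
  smallest component tends to infinity.
\<close>

definition multi_dim :: "('d::finite \<Rightarrow> nat) \<Rightarrow> nat" where
  "multi_dim n = (\<Prod>j\<in>UNIV. n j)"

definition multi_at_top :: "('d::finite \<Rightarrow> nat) filter" where
  "multi_at_top = filtercomap (\<lambda>n. Min (range n)) at_top"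

section \<open>Eigenvalues of matrices with real spectrum\<close>

definition real_spectrum_seq :: "(('d::finite \<Rightarrow> nat) \<Rightarrow> complex mat) \<Rightarrow> bool" where
  "real_spectrum_seq X \<longleftrightarrow>
     (\<forall>n. (\<forall>j. 0 < n j) \<longrightarrow>
        X n \<in> carrier_mat (multi_dim n) (multi_dim n) \<and> (\<forall>z. eigenvalue (X n) z \<longrightarrow> z \<in> \<real>))"

text \<open>
  Eigenvalues are counted with algebraic multiplicity. Taking real parts loses nothing, since
  it is only used for matrices whose eigenvalues are all real.
\<close>

definition eig_mset :: "complex mat \<Rightarrow> real multiset" where
  "eig_mset A = image_mset Re (proots (char_poly A))"

text \<open>The \<open>j\<close>-th smallest eigenvalue, with \<open>j\<close> starting from 1.\<close>

definition eig :: "complex mat \<Rightarrow> nat \<Rightarrow> real" where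
  "eig A j = sorted_list_of_multiset (eig_mset A) ! (j - 1)"

definition d_plus :: "complex mat \<Rightarrow> nat" where
  "d_plus A = size (filter_mset (\<lambda>x. 0 \<le> x) (eig_mset A))"

definition d_minus :: "complex mat \<Rightarrow> nat" where
  "d_minus A = size (filter_mset (\<lambda>x. x < 0) (eig_mset A))"

definition signed_indices :: "complex mat \<Rightarrow> int set" where
  "signed_indices A = {- int (d_minus A)..int (d_plus A)} - {0}"

definition hat_index :: "complex mat \<Rightarrow> int \<Rightarrow> nat" where
  "hat_index A k = nat (if k < 0 then k + int (d_minus A) + 1 else k + int (d_minus A))"

text \<open>
  The two-sided enumeration \<open>\<lambda>\<^sub>k\<close>, where \<open>k \<noteq> 0\<close>: negative indices enumerate the negative
  eigenvalues and positive indices the nonnegative ones.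
\<close>

definition signed_eig :: "complex mat \<Rightarrow> int \<Rightarrow> real" where
  "signed_eig A k = eig A (hat_index A k)"

definition eig_count :: "complex mat \<Rightarrow> real \<Rightarrow> nat" where
  "eig_count A t = card {k \<in> signed_indices A. signed_eig A k \<le> t}"

section \<open>Spectral symbols\<close>

text \<open>
  The last conjunct says that the integral of \<open>\<omega>\<close> over \<open>D\<close> exists, finite or infinite: the
  positive part or the negative part has finite integral.
\<close>

definition admissible_symbol :: "'a::euclidean_space set \<Rightarrow> ('a \<Rightarrow> real) \<Rightarrow> bool" where
  "admissible_symbol D \<omega> \<longleftrightarrow>
     D \<in> sets borel \<and> 0 < emeasure lborel D \<and> emeasure lborel D < \<infinity> \<and>
     \<omega> \<in> borel_measurable (restrict_space borel D) \<and>
     ((\<integral>\<^sup>+y\<in>D. ennreal (\<omega> y) \<partial>lborel) < \<infinity> \<or> (\<integral>\<^sup>+y\<in>D. ennreal (- \<omega> y) \<partial>lborel) < \<infinity>)"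

definition cont_compact_support :: "(real \<Rightarrow> real) set" where
  "cont_compact_support = {F. continuous_on UNIV F \<and> compact (closure {x. F x \<noteq> 0})}"

definition has_spectral_symbol ::
    "(('d::finite \<Rightarrow> nat) \<Rightarrow> complex mat) \<Rightarrow> 'a::euclidean_space set \<Rightarrow> ('a \<Rightarrow> real) \<Rightarrow> bool" where
  "has_spectral_symbol X D \<omega> \<longleftrightarrow>
     admissible_symbol D \<omega> \<and>
     (\<forall>F\<in>cont_compact_support.
        ((\<lambda>n. (\<Sum>k\<in>signed_indices (X n). F (signed_eig (X n) k)) / real (multi_dim n))
          \<longlongrightarrow> (LINT y:D|lborel. F (\<omega> y)) / measure lborel D) multi_at_top)"

section \<open>Essential range and monotone rearrangement\<close>

definition ess_range :: "'a::euclidean_space set \<Rightarrow> ('a \<Rightarrow> real) \<Rightarrow> real set" where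
  "ess_range D \<omega> = {t. \<forall>\<epsilon>>0. emeasure lborel {y \<in> D. \<bar>\<omega> y - t\<bar> < \<epsilon>} > 0}"

definition symbol_cdf :: "'a::euclidean_space set \<Rightarrow> ('a \<Rightarrow> real) \<Rightarrow> real \<Rightarrow> real" where
  "symbol_cdf D \<omega> t = measure lborel {y \<in> D. \<omega> y \<le> t} / measure lborel D"

text \<open>Only meaningful for \<open>x\<close> in the open unit interval.\<close>

definition mono_rearr :: "'a::euclidean_space set \<Rightarrow> ('a \<Rightarrow> real) \<Rightarrow> real \<Rightarrow> real" where
  "mono_rearr D \<omega> x = Inf {t \<in> ess_range D \<omega>. symbol_cdf D \<omega> t > x}"

text \<open>
  The extension to the closed unit interval. It takes extended real values, because the limits
  at the endpoints are infinite when the essential range is unbounded.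
\<close>

definition mono_rearr_ext :: "'a::euclidean_space set \<Rightarrow> ('a \<Rightarrow> real) \<Rightarrow> real \<Rightarrow> ereal" where
  "mono_rearr_ext D \<omega> x =
     (if x = 0 then Lim (at_right 0) (\<lambda>u. ereal (mono_rearr D \<omega> u))
      else if x = 1 then Lim (at_left 1) (\<lambda>u. ereal (mono_rearr D \<omega> u))
      else ereal (mono_rearr D \<omega> x))"

text \<open>Infimum and supremum of a set of reals in the extended reals.\<close>

definition einf :: "real set \<Rightarrow> ereal" where
  "einf S = (INF t\<in>S. ereal t)"

definition esup :: "real set \<Rightarrow> ereal" where
  "esup S = (SUP t\<in>S. ereal t)"

text \<open>
  The upper endpoint of a gap, such as 2 in \<open>{0..1} \<union> {2..3}\<close> (also the minimum of \<open>S\<close>, if any).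
  If \<open>\<omega>\<close> puts mass 1/2 on each of these two intervals, then moving \<open>o(d\<^sub>n)\<close> eigenvalues across the
  gap does not affect the symbol, so eigenvalues of relative index tending to 1/2 from the left may
  converge to 2, may converge to any point of the gap, or may oscillate within it, whereas the left
  limit of the rearrangement at 1/2 is 1. Hence \<open>Sup {t \<in> S. t \<le> L}\<close> is the left limit only if \<open>L\<close>
  is not such a point, while \<open>Sup {t \<in> S. t < L}\<close> is the left limit in all cases.
\<close>

definition upper_gap_edge :: "real set \<Rightarrow> real \<Rightarrow> bool" where
  "upper_gap_edge S L \<longleftrightarrow> L \<in> S \<and> \<not> L islimpt {t \<in> S. t < L}"

section \<open>Eigenvalue index sequences\<close>

definition index_seq :: "(('d::finite \<Rightarrow> nat) \<Rightarrow> nat) \<Rightarrow> bool" where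
  "index_seq k \<longleftrightarrow> (\<forall>n. (\<forall>j. 0 < n j) \<longrightarrow> k n \<in> {1..multi_dim n})"

definition ratio :: "(('d::finite \<Rightarrow> nat) \<Rightarrow> nat) \<Rightarrow> ('d \<Rightarrow> nat) \<Rightarrow> real" where
  "ratio k n = real (k n) / real (multi_dim n)"

text \<open>
  Convergence from the left. Values equal to the limit are allowed, which covers both the strict
  and the non-strict reading.
\<close>

definition tends_from_left :: "('i \<Rightarrow> real) \<Rightarrow> real \<Rightarrow> 'i filter \<Rightarrow> bool" where
  "tends_from_left f x0 G \<longleftrightarrow> (f \<longlongrightarrow> x0) G \<and> (\<forall>\<^sub>F n in G. f n \<le> x0)"

end

(* The law M of \<omega> under normalized Lebesgue measure on D is an atomless probability measure, with
   distribution function \<phi> and support R. On (0,1) the rearrangement is the right inverse of \<phi> with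
   values in R, and x < \<phi> t holds iff the rearrangement at x is below t; so its law under the uniform
   distribution is M again, which gives (a). Testing with trapezoids, and using that M has total mass 1
   so that no eigenvalues escape to infinity, gives (b). Then the eigenvalue of index k is at most t iff
   k \<le> N(t), so (b) traps it between any a and b with \<phi> a < x0 < \<phi> b: every limit point L satisfies
   \<phi> L = x0. The remaining claims follow from this. *)

theory Submission
  imports Defs "HOL-Probability.Distribution_Functions"
    "HOL-Computational_Algebra.Fundamental_Theorem_Algebra"
begin

section \<open>Atomless distributions on the real line\<close>

text \<open>The topological support. Symmetric open intervals are used because they match the sets
  in \<open>ess_range\<close> literally once \<open>M\<close> is the law of a symbol.\<close>

definition supp :: "real measure \<Rightarrow> real set" where
  "supp M = {t. \<forall>\<epsilon>>0. 0 < measure M {t - \<epsilon><..<t + \<epsilon>}}"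

definition quantile :: "real measure \<Rightarrow> real \<Rightarrow> real" where
  "quantile M x = Inf {t \<in> supp M. cdf M t > x}"

locale atomless_distribution = real_distribution M for M +
  assumes atomless: "measure M {t} = 0"
begin

lemma cdf_continuous: "isCont (cdf M) t"
  by (simp add: isCont_cdf atomless)

lemma cdf_continuous_at_within: "(cdf M \<longlongrightarrow> cdf M t) (at t within S)"
  using cdf_continuous[of t] continuous_at_imp_continuous_at_within continuous_within by blast

lemma measure_Ioo:
  assumes "a < b"
  shows "measure M {a<..<b} = cdf M b - cdf M a"
proof -
  have "measure M {a<..b} = measure M ({a<..<b} \<union> {b})"
    using assms by (intro arg_cong[where f = "measure M"]) auto
  also have "\<dots> = measure M {a<..<b} + measure M {b}"
    by (intro finite_measure_Union) auto
  finally show ?thesis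
    using cdf_diff_eq[OF assms] atomless by simp
qed

text \<open>Without atoms the mass of an open interval is the increment of the \<open>cdf\<close>,
  so the support consists of the points of increase of the \<open>cdf\<close>.\<close>

lemma mem_supp_iff: "t \<in> supp M \<longleftrightarrow> (\<forall>a b. a < t \<and> t < b \<longrightarrow> cdf M a < cdf M b)"
proof
  assume t: "t \<in> supp M"
  show "\<forall>a b. a < t \<and> t < b \<longrightarrow> cdf M a < cdf M b"
  proof (intro allI impI, elim conjE)
    fix a b assume ab: "a < t" "t < b"
    define e where "e = min (t - a) (b - t)"
    have e: "e > 0" using ab by (simp add: e_def)
    then have "cdf M (t - e) < cdf M (t + e)"
      using t measure_Ioo[of "t - e" "t + e"] by (auto simp: supp_def)
    moreover have "cdf M a \<le> cdf M (t - e)" "cdf M (t + e) \<le> cdf M b"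
      by (auto intro!: cdf_nondecreasing simp: e_def)
    ultimately show "cdf M a < cdf M b" by linarith
  qed
next
  assume *: "\<forall>a b. a < t \<and> t < b \<longrightarrow> cdf M a < cdf M b"
  show "t \<in> supp M"
    using * by (simp add: supp_def measure_Ioo)
qed

text \<open>Take \<open>s\<close> to be the right end of the level set of \<open>x\<close>.
  Continuity puts \<open>s\<close> on the level \<open>x\<close> itself, and
  \<open>cdf M a \<le> x < cdf M b\<close> for \<open>a < s < b\<close> makes it a point of
  increase, hence a support point.\<close>

lemma cdf_level:
  assumes x: "0 < x" "x < 1"
  obtains s where "s \<in> supp M" "cdf M s = x" "\<And>t. x < cdf M t \<longleftrightarrow> s < t"
proof -
  define S where "S = {t. x < cdf M t}"
  obtain u where u: "u \<in> S"
    using order_tendstoD(1)[OF cdf_lim_at_top_prob x(2)]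
    by (auto simp: eventually_at_top_linorder S_def)
  obtain l where l: "cdf M l < x"
    using order_tendstoD(2)[OF cdf_lim_at_bot x(1)]
    by (auto simp: eventually_at_bot_linorder)
  have bdd: "bdd_below S"
  proof (rule bdd_belowI)
    fix t assume "t \<in> S"
    then show "l \<le> t" using l cdf_nondecreasing[of t l] by (force simp: S_def)
  qed
  define s where "s = Inf S"
  have iff: "x < cdf M t \<longleftrightarrow> s < t" for t
  proof
    assume t: "x < cdf M t"
    have "\<forall>\<^sub>F y in at_left t. x < cdf M y"
      using order_tendstoD(1)[OF cdf_continuous_at_within t] .
    then obtain b where b: "b < t" "\<And>y. b < y \<Longrightarrow> y < t \<Longrightarrow> x < cdf M y"
      by (auto simp: eventually_at_left_field)
    \<comment> \<open>By left continuity some point strictly below \<open>t\<close> still lies in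
      \<open>S\<close>, so the infimum is strictly below \<open>t\<close>.\<close>
    obtain y where "b < y" "y < t" using b dense by blast
    then have "s \<le> y" unfolding s_def using b by (intro cInf_lower bdd) (auto simp: S_def)
    then show "s < t" using \<open>y < t\<close> by simp
  next
    assume "s < t"
    then obtain t' where "t' \<in> S" "t' < t"
      using u cInf_lessD[of S t] by (auto simp: s_def)
    then show "x < cdf M t" using cdf_nondecreasing[of t' t] by (simp add: S_def)
  qed
  have "cdf M s = x"
  proof (rule antisym)
    show "cdf M s \<le> x" using iff[of s] by simp
    have "\<forall>\<^sub>F t in at_right s. x \<le> cdf M t"
      by (rule eventually_mono[OF eventually_at_right_less]) (simp add: iff less_imp_le)
    then show "x \<le> cdf M s"
      by (intro tendsto_lowerbound[OF cdf_continuous_at_within]) auto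
  qed
  moreover have "s \<in> supp M"
    unfolding mem_supp_iff using iff \<open>cdf M s = x\<close> cdf_nondecreasing
    by (metis less_le_not_le order_le_less_trans)
  ultimately show thesis using that iff by blast
qed

text \<open>The infimum defining \<open>quantile\<close> is the point \<open>s\<close> of
  \<open>cdf_level\<close>. Restricting it to support points does not raise it, since levels
  slightly above \<open>x\<close> are attained at support points arbitrarily close to
  \<open>s\<close>.\<close>

lemma
  assumes x: "0 < x" "x < 1"
  shows quantile_in_supp: "quantile M x \<in> supp M"
    and cdf_quantile: "cdf M (quantile M x) = x"
    and less_cdf_iff: "x < cdf M t \<longleftrightarrow> quantile M x < t"
proof -
  obtain s where s: "s \<in> supp M" "cdf M s = x" "\<And>t. x < cdf M t \<longleftrightarrow> s < t"
    using cdf_level[OF x] by blast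
  have "Inf {t \<in> supp M. x < cdf M t} = s"
  proof (rule cInf_eq_non_empty)
    \<comment> \<open>A level strictly between \<open>x\<close> and 1 shows that the set is
      nonempty, so that its \<open>Inf\<close> is a genuine infimum.\<close>
    obtain t where t: "t \<in> supp M" "cdf M t = (x + 1) / 2"
      using cdf_level[of "(x + 1) / 2"] x by auto
    then have "t \<in> {t \<in> supp M. x < cdf M t}" using x by simp
    then show "{t \<in> supp M. x < cdf M t} \<noteq> {}" by blast
  next
    show "s \<le> t" if "t \<in> {t \<in> supp M. x < cdf M t}" for t
      using that s(3) by auto
  next
    fix y assume y: "y \<le> t" if "t \<in> {t \<in> supp M. x < cdf M t}" for t
    show "y \<le> s"
    proof (rule ccontr)
      assume "\<not> y \<le> s"
      then have xy: "x < cdf M y" using s(3) by simp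
      \<comment> \<open>At a level strictly between \<open>x\<close> and \<open>cdf M y\<close>
        there is a support point below \<open>y\<close>, against the choice of \<open>y\<close> as a
        lower bound.\<close>
      define z where "z = (x + cdf M y) / 2"
      have z: "x < z" "z < cdf M y" using xy by (simp_all add: z_def)
      obtain t where t: "t \<in> supp M" "cdf M t = z" "\<And>u. z < cdf M u \<longleftrightarrow> t < u"
        using cdf_level[of z] z x cdf_bounded_prob[of y] by auto
      then have "t < y" "y \<le> t" using y[of t] z by auto
      then show False by simp
    qed
  qed
  then have "quantile M x = s" by (simp add: quantile_def)
  then show "quantile M x \<in> supp M" "cdf M (quantile M x) = x"
    "x < cdf M t \<longleftrightarrow> quantile M x < t"
    using s by auto
qed

lemma quantile_mono: "0 < x \<Longrightarrow> x \<le> y \<Longrightarrow> y < 1 \<Longrightarrow> quantile M x \<le> quantile M y"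
  using less_cdf_iff[of x "quantile M y"] cdf_quantile[of y]
    less_cdf_iff[of x "quantile M x"]
  by (cases "x = y") auto

section \<open>Endpoints of the support and one-sided limits of the quantile function\<close>

lemma einf_supp_less_iff: "einf (supp M) < ereal t \<longleftrightarrow> 0 < cdf M t"
proof
  assume "einf (supp M) < ereal t"
  then obtain s where s: "s \<in> supp M" "s < t"
    by (auto simp: einf_def INF_less_iff)
  \<comment> \<open>Any point to the left of \<open>s\<close> would serve: \<open>s\<close> is a
    point of increase.\<close>
  then have "cdf M (s - 1) < cdf M t" by (auto simp: mem_supp_iff)
  then show "0 < cdf M t" using cdf_nonneg[of "s - 1"] by linarith
next
  assume t: "0 < cdf M t"
  \<comment> \<open>A level strictly between 0 and \<open>cdf M t\<close>; its quantile is a support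
    point below \<open>t\<close>.\<close>
  define x where "x = cdf M t / 2"
  have x: "0 < x" "x < 1" "x < cdf M t" using t cdf_bounded_prob[of t] by (auto simp: x_def)
  then show "einf (supp M) < ereal t"
    using less_cdf_iff[of x t] quantile_in_supp[of x] by (auto simp: einf_def INF_less_iff)
qed

lemma less_esup_supp_iff: "ereal t < esup (supp M) \<longleftrightarrow> cdf M t < 1"
proof
  assume "ereal t < esup (supp M)"
  then obtain s where s: "s \<in> supp M" "t < s"
    by (auto simp: esup_def less_SUP_iff)
  then have "cdf M t < cdf M (s + 1)" by (auto simp: mem_supp_iff)
  then show "cdf M t < 1" using cdf_bounded_prob[of "s + 1"] by linarith
next
  assume t: "cdf M t < 1"
  define x where "x = (cdf M t + 1) / 2"
  have x: "0 < x" "x < 1" "cdf M t < x" using t cdf_nonneg[of t] by (auto simp: x_def)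
  then have "cdf M t < cdf M (quantile M x)" using cdf_quantile by simp
  then have "t < quantile M x" using cdf_nondecreasing[of "quantile M x" t] by linarith
  then show "ereal t < esup (supp M)"
    using quantile_in_supp[of x] x by (auto simp: esup_def less_SUP_iff)
qed

text \<open>Quantiles are support points, so they never fall below the infimum; they drop below any
  \<open>t\<close> above it as soon as \<open>x < cdf M t\<close>. Working in the extended reals
  treats bounded and unbounded supports alike.\<close>

lemma quantile_tendsto_einf:
  "((\<lambda>x. ereal (quantile M x)) \<longlongrightarrow> einf (supp M)) (at_right 0)"
proof (rule order_tendstoI)
  fix a assume a: "a < einf (supp M)"
  have "a < ereal (quantile M x)" if "0 < x" "x < 1" for x
    using a quantile_in_supp[OF that] by (auto simp: einf_def intro: less_le_trans INF_lower)
  then show "\<forall>\<^sub>F x in at_right 0. a < ereal (quantile M x)"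
    by (auto simp: eventually_at_right_field intro: exI[of _ 1])
next
  fix a assume "einf (supp M) < a"
  then obtain t where t: "einf (supp M) < ereal t" "ereal t < a"
    using ereal_dense2 by blast
  then have c: "0 < cdf M t" by (simp add: einf_supp_less_iff)
  have "ereal (quantile M x) < a" if "0 < x" "x < cdf M t" for x
    using less_cdf_iff[of x t] that cdf_bounded_prob[of t] t(2)
    by (metis less_ereal.simps(1) order_less_le_trans order_less_trans)
  then show "\<forall>\<^sub>F x in at_right 0. ereal (quantile M x) < a"
    using c by (auto simp: eventually_at_right_field)
qed

lemma quantile_tendsto_esup:
  "((\<lambda>x. ereal (quantile M x)) \<longlongrightarrow> esup (supp M)) (at_left 1)"
proof (rule order_tendstoI)
  fix a assume a: "esup (supp M) < a"
  have "ereal (quantile M x) < a" if "0 < x" "x < 1" for x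
    using a quantile_in_supp[OF that] by (auto simp: esup_def intro: le_less_trans[rotated] SUP_upper)
  then show "\<forall>\<^sub>F x in at_left 1. ereal (quantile M x) < a"
    by (auto simp: eventually_at_left_field intro: exI[of _ 0])
next
  fix a assume "a < esup (supp M)"
  then obtain t where t: "a < ereal t" "ereal t < esup (supp M)"
    using ereal_dense2 by blast
  then have c: "cdf M t < 1" by (simp add: less_esup_supp_iff)
  have "a < ereal (quantile M x)" if "cdf M t < x" "x < 1" for x
  proof -
    have "0 < x" using that cdf_nonneg[of t] by linarith
    then have "t \<le> quantile M x"
      using less_cdf_iff[of x t] that by auto
    then show ?thesis using t(1) by (simp add: less_le_trans)
  qed
  then show "\<forall>\<^sub>F x in at_left 1. a < ereal (quantile M x)"
    using c by (auto simp: eventually_at_left_field)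
qed

text \<open>Here \<open>L\<close> may be any point of the level set of \<open>x0\<close>, which is
  an interval when \<open>M\<close> has a gap there. Quantiles of levels below \<open>x0\<close> are
  support points below \<open>L\<close>, and they pass every \<open>a\<close> that lies below such a
  support point because \<open>cdf M a < x0\<close>.\<close>

lemma
  assumes x0: "0 < x0" "x0 < 1" and L: "cdf M L = x0"
  shows supp_below_nonempty: "{t \<in> supp M. t < L} \<noteq> {}"
    and quantile_left_limit: "(quantile M \<longlongrightarrow> Sup {t \<in> supp M. t < L}) (at_left x0)"
proof -
  let ?S = "{t \<in> supp M. t < L}"
  have mem: "quantile M x \<in> ?S" if "0 < x" "x < x0" for x
    using that x0 L quantile_in_supp[of x] less_cdf_iff[of x L] by auto
  show ne: "?S \<noteq> {}" using mem[of "x0 / 2"] x0 by auto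
  have bdd: "bdd_above ?S" by (auto intro!: bdd_aboveI[of _ L])
  show "(quantile M \<longlongrightarrow> Sup ?S) (at_left x0)"
  proof (rule order_tendstoI)
    fix a assume "a < Sup ?S"
    then obtain t where t: "t \<in> supp M" "t < L" "a < t"
      using less_cSupD[OF ne] by blast
    then have a: "cdf M a < x0" using L by (auto simp: mem_supp_iff)
    have "a < quantile M x" if "cdf M a < x" "x < x0" for x
    proof -
      have "0 < x" using that cdf_nonneg[of a] by linarith
      then have "cdf M a < cdf M (quantile M x)" using that x0 by (simp add: cdf_quantile)
      then show ?thesis using cdf_nondecreasing[of "quantile M x" a] by linarith
    qed
    then show "\<forall>\<^sub>F x in at_left x0. a < quantile M x"
      using a by (auto simp: eventually_at_left_field)
  next
    fix b assume b: "Sup ?S < b"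
    have "quantile M x < b" if "0 < x" "x < x0" for x
      using cSup_upper[OF mem[OF that] bdd] b by simp
    then show "\<forall>\<^sub>F x in at_left x0. quantile M x < b"
      using x0 by (auto simp: eventually_at_left_field)
  qed
qed

end

text \<open>The two sets can differ only by \<open>L\<close>. If \<open>L\<close> belongs to
  \<open>S\<close> and is no upper gap edge, points of \<open>S\<close> accumulate at
  \<open>L\<close> from below, so both suprema equal \<open>L\<close>.\<close>

lemma Sup_below_eq_Sup_upto:
  assumes "\<not> upper_gap_edge S L" "{t \<in> S. t < L} \<noteq> {}"
  shows "Sup {t \<in> S. t \<le> L} = Sup {t \<in> S. t < L}"
proof (cases "L \<in> S")
  case False
  then have "{t \<in> S. t \<le> L} = {t \<in> S. t < L}" by (auto simp: less_le)
  then show ?thesis by simp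
next
  case True
  then have lim: "L islimpt {t \<in> S. t < L}" using assms(1) by (simp add: upper_gap_edge_def)
  have "Sup {t \<in> S. t \<le> L} = L"
    using True by (intro cSup_eq_maximum) auto
  moreover have "Sup {t \<in> S. t < L} = L"
  proof (rule cSup_eq_non_empty[OF assms(2)])
    fix y assume y: "t \<le> y" if "t \<in> {t \<in> S. t < L}" for t
    show "L \<le> y"
    proof (rule ccontr)
      assume "\<not> L \<le> y"
      then obtain t where "t \<in> S" "t < L" "y < t"
        using lim islimptE[of L "{t \<in> S. t < L}" "{y<..}"] by auto
      then show False using y[of t] by auto
    qed
  qed auto
  ultimately show ?thesis by simp
qed

section \<open>Vaguely equidistributed ordered arrays\<close>

text \<open>The row \<open>n\<close> of the array is \<open>e n 1 \<le> \<dots> \<le> e n (d n)\<close>.\<close>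

definition array_count :: "('i \<Rightarrow> nat) \<Rightarrow> ('i \<Rightarrow> nat \<Rightarrow> real) \<Rightarrow> 'i \<Rightarrow> real \<Rightarrow> nat" where
  "array_count d e n t = card {j \<in> {1..d n}. e n j \<le> t}"

text \<open>An abstraction of the ordered eigenvalues. The conditions on rows are only eventual,
  since the matrices are constrained only at multi-indices with positive entries. Test functions
  have compact support, so that no mass escapes to infinity has to be derived from \<open>M\<close>
  being a probability measure.\<close>

locale vague_equidistribution = atomless_distribution M
  for M :: "real measure" and G :: "'i filter" and d :: "'i \<Rightarrow> nat" and e :: "'i \<Rightarrow> nat \<Rightarrow> real" +
  assumes dim_pos: "\<forall>\<^sub>F n in G. 0 < d n"
    and row_mono: "\<forall>\<^sub>F n in G. mono_on {1..d n} (e n)"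
    and vague: "F \<in> cont_compact_support \<Longrightarrow>
      ((\<lambda>n. (\<Sum>j\<in>{1..d n}. F (e n j)) / real (d n)) \<longlongrightarrow> (LINT x|M. F x)) G"

text \<open>For \<open>a \<le> b\<close> this is the trapezoid with value 1 on \<open>{a..b}\<close>
  and linear ramps of width \<open>\<delta>\<close>; it turns vague convergence into bounds on the
  fraction of entries in an interval.\<close>

lemma trapezoid_exists:
  fixes a b \<delta> :: real
  assumes "0 < \<delta>"
  obtains F where "F \<in> cont_compact_support"
    "\<And>x. indicator {a..b} x \<le> F x" "\<And>x. F x \<le> indicator {a - \<delta><..<b + \<delta>} x"
proof -
  define F where "F x = max 0 (1 - max 0 (max (a - x) (x - b)) / \<delta>)" for x
  have F0: "F x = 0" if "x \<notin> {a - \<delta><..<b + \<delta>}" for x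
    using that assms by (auto simp: F_def max_def field_simps)
  have "continuous_on UNIV F"
    using assms unfolding F_def by (intro continuous_intros) auto
  moreover have "closure {x. F x \<noteq> 0} \<subseteq> {a - \<delta>..b + \<delta>}"
  proof (intro closure_minimal subsetI)
    fix x assume "x \<in> {x. F x \<noteq> 0}"
    then have "x \<in> {a - \<delta><..<b + \<delta>}" using F0[of x] by blast
    then show "x \<in> {a - \<delta>..b + \<delta>}" by simp
  qed simp
  then have "compact (closure {x. F x \<noteq> 0})"
    by (meson bounded_closed_interval bounded_subset closed_closure compact_eq_bounded_closed)
  ultimately have "F \<in> cont_compact_support"
    by (simp add: cont_compact_support_def)
  moreover have "indicator {a..b} x \<le> F x" for x
    by (auto simp: F_def indicator_def)
  moreover have "F x \<le> 1" for x
    using assms by (simp add: F_def)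
  then have "F x \<le> indicator {a - \<delta><..<b + \<delta>} x" for x
    using F0[of x] by (auto simp: indicator_def)
  ultimately show thesis using that by blast
qed

section \<open>Convergence of the counting function\<close>

context vague_equidistribution
begin

text \<open>The integral of the trapezoid is at least the mass of \<open>{a..b}\<close>, and its row
  averages are at most the fraction of entries in the enlarged interval. Upper bounds on fractions
  are later obtained from this by passing to complements.\<close>

lemma eventually_fraction_in_Ioo_gt:
  assumes "a \<le> b" "0 < \<delta>" "y < cdf M b - cdf M a"
  shows "\<forall>\<^sub>F n in G. y < card {j \<in> {1..d n}. e n j \<in> {a - \<delta><..<b + \<delta>}} / d n"
proof -
  obtain F where F: "F \<in> cont_compact_support"
    "\<And>x. indicator {a..b} x \<le> F x" "\<And>x. F x \<le> indicator {a - \<delta><..<b + \<delta>} x"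
    using trapezoid_exists[OF assms(2)] by blast
  have [measurable]: "F \<in> borel_measurable borel"
    using F(1) by (intro borel_measurable_continuous_onI) (auto simp: cont_compact_support_def)
  have F_bounds: "0 \<le> F x" "F x \<le> 1" for x
    by (rule order_trans[OF indicator_pos_le F(2)], rule order_trans[OF F(3) indicator_le_1])
  have int: "integrable M F"
    using F_bounds by (intro integrable_const_bound[of _ 1]) (auto simp: measurable_finite_borel)
  have "cdf M b - cdf M a \<le> measure M {a..b}"
  proof (cases "a = b")
    case False
    then have "cdf M b - cdf M a = measure M {a<..b}"
      using assms(1) by (intro cdf_diff_eq) auto
    also have "\<dots> \<le> measure M {a..b}" by (intro finite_measure_mono) auto
    finally show ?thesis .
  qed auto
  also have "\<dots> = (LINT x|M. indicator {a..b} x)" by simp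
  also have "\<dots> \<le> (LINT x|M. F x)"
    using F(2) by (intro integral_mono int) (auto simp: integrable_indicator_iff emeasure_eq_measure)
  finally have "y < (LINT x|M. F x)" using assms(3) by simp
  from order_tendstoD(1)[OF vague[OF F(1)] this]
  show ?thesis
  proof (rule eventually_mono)
    fix n assume y: "y < (\<Sum>j\<in>{1..d n}. F (e n j)) / real (d n)"
    have "(\<Sum>j\<in>{1..d n}. F (e n j)) \<le> (\<Sum>j\<in>{1..d n}. indicator {a - \<delta><..<b + \<delta>} (e n j))"
      by (intro sum_mono F(3))
    also have "\<dots> = card {j \<in> {1..d n}. e n j \<in> {a - \<delta><..<b + \<delta>}}"
      by (simp add: indicator_def sum.If_cases Int_def)
    finally show "y < card {j \<in> {1..d n}. e n j \<in> {a - \<delta><..<b + \<delta>}} / d n"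
      using y by (smt (verit) divide_right_mono of_nat_0_le_iff)
  qed
qed

lemma array_count_tendsto_cdf: "((\<lambda>n. array_count d e n t / d n) \<longlongrightarrow> cdf M t) G"
proof (rule order_tendstoI)
  fix y assume y: "y < cdf M t"
  have "\<forall>\<^sub>F s in at_left t. y < cdf M s"
    using order_tendstoD(1)[OF cdf_continuous_at_within y] .
  then obtain s0 where "s0 < t" "\<And>s. s0 < s \<Longrightarrow> s < t \<Longrightarrow> y < cdf M s"
    by (auto simp: eventually_at_left_field)
  \<comment> \<open>The gap between \<open>s\<close> and \<open>t\<close> leaves room for the ramp:
    with \<open>\<delta> = t - s\<close> the enlarged interval ends exactly at
    \<open>t\<close>.\<close>
  then obtain s where s: "s < t" "y < cdf M s" using dense by metis
  have "\<forall>\<^sub>F m in at_bot. cdf M m < cdf M s - y"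
    using order_tendstoD(2)[OF cdf_lim_at_bot] s by simp
  then obtain m0 where m0: "\<And>m. m \<le> m0 \<Longrightarrow> cdf M m < cdf M s - y"
    by (auto simp: eventually_at_bot_linorder)
  define m where "m = min m0 s"
  have m: "m \<le> s" "y < cdf M s - cdf M m" using m0[of m] by (auto simp: m_def)
  have "0 < t - s" using s by simp
  from eventually_fraction_in_Ioo_gt[OF m(1) this m(2)]
  show "\<forall>\<^sub>F n in G. y < array_count d e n t / d n"
  proof eventually_elim
    case (elim n)
    have "card {j \<in> {1..d n}. e n j \<in> {m - (t - s)<..<s + (t - s)}} \<le> array_count d e n t"
      unfolding array_count_def by (intro card_mono) auto
    then show "y < array_count d e n t / d n"
      using elim by (smt (verit) divide_right_mono of_nat_0_le_iff of_nat_mono)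
  qed
next
  fix y assume y: "cdf M t < y"
  have "\<forall>\<^sub>F s in at_right t. cdf M s < y"
    using order_tendstoD(2)[OF cdf_continuous_at_within y] .
  then obtain s0 where "t < s0" "\<And>s. t < s \<Longrightarrow> s < s0 \<Longrightarrow> cdf M s < y"
    by (auto simp: eventually_at_right_field)
  then obtain s where s: "t < s" "cdf M s < y" using dense by metis
  \<comment> \<open>Total mass 1 enters here: a fraction above \<open>1 - y\<close> of the entries
    lies in a bounded interval to the right of \<open>t\<close>, which leaves a fraction below
    \<open>y\<close> for the entries up to \<open>t\<close>.\<close>
  have "\<forall>\<^sub>F m in at_top. 1 - y + cdf M s < cdf M m"
    using order_tendstoD(1)[OF cdf_lim_at_top_prob] s by simp
  then obtain m0 where m0: "\<And>m. m0 \<le> m \<Longrightarrow> 1 - y + cdf M s < cdf M m"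
    by (auto simp: eventually_at_top_linorder)
  define m where "m = max m0 s"
  have m: "s \<le> m" "1 - y < cdf M m - cdf M s" using m0[of m] by (auto simp: m_def)
  have "0 < s - t" using s by simp
  from eventually_fraction_in_Ioo_gt[OF m(1) this m(2)] dim_pos
  show "\<forall>\<^sub>F n in G. array_count d e n t / d n < y"
  proof eventually_elim
    fix n assume *: "1 - y < card {j \<in> {1..d n}. e n j \<in> {s - (s - t)<..<m + (s - t)}} / d n"
      and d: "0 < d n"
    let ?A = "{j \<in> {1..d n}. e n j \<in> {s - (s - t)<..<m + (s - t)}}"
    let ?B = "{j \<in> {1..d n}. e n j \<le> t}"
    have "card ?A + card ?B = card (?A \<union> ?B)"
      by (rule card_Un_disjoint[symmetric]) auto
    also have "\<dots> \<le> card {1..d n}" by (intro card_mono) auto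
    finally have "real (card ?A) + real (array_count d e n t) \<le> d n"
      unfolding array_count_def by simp
    then have "card ?A / d n + array_count d e n t / d n \<le> 1"
      using d by (simp add: field_simps)
    then show "array_count d e n t / d n < y" using * by linarith
  qed
qed

text \<open>In an ascending row the entries up to \<open>t\<close> occupy an initial segment of
  indices, whose length is the count. The quantifier over \<open>t\<close> stands inside, so one
  threshold for \<open>n\<close> serves all \<open>t\<close>.\<close>

lemma eventually_entry_le_iff:
  assumes "\<forall>\<^sub>F n in G. k n \<in> {1..d n}"
  shows "\<forall>\<^sub>F n in G. \<forall>t. e n (k n) \<le> t \<longleftrightarrow> k n \<le> array_count d e n t"
  using row_mono assms
proof eventually_elim
  fix n assume mono: "mono_on {1..d n} (e n)" and k: "k n \<in> {1..d n}"
  show "\<forall>t. e n (k n) \<le> t \<longleftrightarrow> k n \<le> array_count d e n t"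
  proof (intro allI iffI)
    fix t assume t: "e n (k n) \<le> t"
    have "{1..k n} \<subseteq> {j \<in> {1..d n}. e n j \<le> t}"
      using t k mono_onD[OF mono, of _ "k n"] by force
    from card_mono[OF _ this] show "k n \<le> array_count d e n t"
      by (simp add: array_count_def)
  next
    fix t assume c: "k n \<le> array_count d e n t"
    show "e n (k n) \<le> t"
    proof (rule ccontr)
      assume t: "\<not> e n (k n) \<le> t"
      have "{j \<in> {1..d n}. e n j \<le> t} \<subseteq> {1..<k n}"
        using t k mono_onD[OF mono, of "k n"] by (force simp: not_le)
      from card_mono[OF _ this] show False
        using c k by (auto simp: array_count_def)
    qed
  qed
qed

section \<open>Entries of prescribed asymptotic relative index\<close>

context
  fixes k :: "'i \<Rightarrow> nat" and x :: real
  assumes index: "\<forall>\<^sub>F n in G. k n \<in> {1..d n}"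
    and ratio: "((\<lambda>n. real (k n) / real (d n)) \<longlongrightarrow> x) G"
begin

text \<open>The counted fraction tends to \<open>cdf M t\<close> and the relative index to the
  larger \<open>x\<close>, so the index eventually exceeds the count. No bounds on \<open>x\<close>
  are imposed, which lets the endpoint results use the values 0 and 1.\<close>

lemma eventually_entry_gt:
  assumes "cdf M t < x"
  shows "\<forall>\<^sub>F n in G. t < e n (k n)"
proof -
  obtain y where y: "cdf M t < y" "y < x" using assms dense by blast
  have "\<forall>\<^sub>F n in G. array_count d e n t / d n < y"
    using order_tendstoD(2)[OF array_count_tendsto_cdf y(1)] .
  moreover have "\<forall>\<^sub>F n in G. y < k n / d n"
    using order_tendstoD(1)[OF ratio y(2)] .
  ultimately show ?thesis
    using dim_pos eventually_entry_le_iff[OF index]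
  proof eventually_elim
    case (elim n)
    then have "array_count d e n t / d n < k n / d n" by linarith
    then have "array_count d e n t < k n" using elim(3) by (simp add: divide_less_cancel)
    then show ?case using elim(4) by (meson not_le)
  qed
qed

lemma eventually_entry_le:
  assumes "x < cdf M t"
  shows "\<forall>\<^sub>F n in G. e n (k n) \<le> t"
proof -
  obtain y where y: "x < y" "y < cdf M t" using assms dense by blast
  have "\<forall>\<^sub>F n in G. y < array_count d e n t / d n"
    using order_tendstoD(1)[OF array_count_tendsto_cdf y(2)] .
  moreover have "\<forall>\<^sub>F n in G. k n / d n < y"
    using order_tendstoD(2)[OF ratio y(1)] .
  ultimately show ?thesis
    using dim_pos eventually_entry_le_iff[OF index]
  proof eventually_elim
    case (elim n)
    then have "k n / d n < array_count d e n t / d n" by linarith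
    then have "k n < array_count d e n t" using elim(3) by (simp add: divide_less_cancel)
    then show ?case using elim(4) by simp
  qed
qed

lemma entries_eventually_in_compact:
  assumes x: "0 < x" "x < 1"
  obtains a b where "einf (supp M) < ereal a" "ereal b < esup (supp M)"
    "\<forall>\<^sub>F n in G. a \<le> e n (k n) \<and> e n (k n) \<le> b"
proof -
  \<comment> \<open>The levels \<open>x / 2\<close> and \<open>(x + 1) / 2\<close> enclose
    \<open>x\<close> and stay strictly inside the unit interval, so \<open>a\<close> and
    \<open>b\<close> stay strictly between the endpoints of the support.\<close>
  obtain a where a: "cdf M a = x / 2" using cdf_quantile[of "x / 2"] x by auto
  obtain b where b: "cdf M b = (x + 1) / 2" using cdf_quantile[of "(x + 1) / 2"] x by auto
  have "\<forall>\<^sub>F n in G. a \<le> e n (k n) \<and> e n (k n) \<le> b"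
    using eventually_entry_gt[of a] eventually_entry_le[of b] a b x
    by (auto elim: eventually_elim2)
  then show thesis
    using that[of a b] a b x by (simp add: einf_supp_less_iff less_esup_supp_iff)
qed

text \<open>Subfilters \<open>H\<close> play the role of subsequences, so oscillating entries are
  covered. A point \<open>t < L\<close> with \<open>cdf M t > x\<close> would eventually bound the
  entries by \<open>t\<close>, and symmetrically on the right; continuity of the \<open>cdf\<close>
  then gives equality at \<open>L\<close>.\<close>

lemma cdf_limit_point:
  assumes H: "H \<le> G" "H \<noteq> bot" and L: "((\<lambda>n. e n (k n)) \<longlongrightarrow> L) H"
  shows "cdf M L = x"
proof (rule antisym)
  have "cdf M t \<le> x" if t: "t < L" for t
  proof (rule ccontr)
    assume "\<not> cdf M t \<le> x"
    then have "\<forall>\<^sub>F n in H. e n (k n) \<le> t"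
      using eventually_entry_le[of t] filter_leD[OF H(1)] by simp
    then have "L \<le> t" using tendsto_upperbound[OF L _ H(2)] by blast
    with t show False by simp
  qed
  then have "\<forall>\<^sub>F t in at_left L. cdf M t \<le> x"
    by (auto simp: eventually_at_left_field intro: exI[of _ "L - 1"])
  then show "cdf M L \<le> x"
    by (intro tendsto_upperbound[OF cdf_continuous_at_within]) auto
  have "x \<le> cdf M t" if t: "L < t" for t
  proof (rule ccontr)
    assume "\<not> x \<le> cdf M t"
    then have "\<forall>\<^sub>F n in H. t < e n (k n)"
      using eventually_entry_gt[of t] filter_leD[OF H(1)] by simp
    then have "t \<le> L"
      by (intro tendsto_lowerbound[OF L _ H(2)]) (auto elim: eventually_mono)
    with t show False by simp
  qed
  then have "\<forall>\<^sub>F t in at_right L. x \<le> cdf M t"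
    by (auto simp: eventually_at_right_field intro: exI[of _ "L + 1"])
  then show "x \<le> cdf M L"
    by (intro tendsto_lowerbound[OF cdf_continuous_at_within]) auto
qed

lemma entries_tendsto_quantile:
  assumes x: "0 < x" "x < 1" and cont: "continuous (at_left x) (quantile M)"
  shows "((\<lambda>n. e n (k n)) \<longlongrightarrow> quantile M x) G"
proof (rule order_tendstoI)
  fix a assume "a < quantile M x"
  then have "\<forall>\<^sub>F u in at_left x. a < quantile M u"
    using cont by (auto simp: continuous_within intro: order_tendstoD)
  then obtain u0 where u0: "u0 < x" "\<And>u. u0 < u \<Longrightarrow> u < x \<Longrightarrow> a < quantile M u"
    by (auto simp: eventually_at_left_field)
  \<comment> \<open>The maximum with 0 keeps \<open>u\<close> in the open unit interval, where
    \<open>less_cdf_iff\<close> applies. Left continuity thus yields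
    \<open>cdf M a \<le> u < x\<close>.\<close>
  obtain u where u: "max u0 0 < u" "u < x" using dense[of "max u0 0" x] u0 x by auto
  then have "cdf M a \<le> u" using u0(2)[of u] less_cdf_iff[of u a] x by auto
  then show "\<forall>\<^sub>F n in G. a < e n (k n)"
    using eventually_entry_gt[of a] u by simp
next
  fix a assume a: "quantile M x < a"
  \<comment> \<open>The intermediate \<open>b\<close> turns the non-strict bound of
    \<open>eventually_entry_le\<close> into a strict bound by \<open>a\<close>.\<close>
  then obtain b where b: "quantile M x < b" "b < a" using dense by blast
  then have "x < cdf M b" using less_cdf_iff[OF x] by simp
  from eventually_entry_le[OF this]
  show "\<forall>\<^sub>F n in G. e n (k n) < a" using b by (auto elim: eventually_mono)
qed

end

text \<open>Every \<open>t\<close> above the infimum has \<open>cdf M t > 0\<close>, so entries of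
  relative index tending to 0 are eventually at most \<open>t\<close>. Vague convergence cannot
  control a vanishing fraction of entries below the support; \<open>ge\<close> rules these
  out.\<close>

lemma entries_tendsto_einf:
  assumes k: "\<forall>\<^sub>F n in G. k n \<in> {1..d n}" "((\<lambda>n. real (k n) / real (d n)) \<longlongrightarrow> 0) G"
    and ge: "\<forall>\<^sub>F n in G. einf (supp M) \<le> ereal (e n (k n))"
  shows "((\<lambda>n. ereal (e n (k n))) \<longlongrightarrow> einf (supp M)) G"
proof (rule order_tendstoI)
  fix a assume "a < einf (supp M)"
  then show "\<forall>\<^sub>F n in G. a < ereal (e n (k n))"
    using ge by (auto elim!: eventually_mono)
next
  fix a assume "einf (supp M) < a"
  then obtain t where t: "einf (supp M) < ereal t" "ereal t < a"
    using ereal_dense2 by blast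
  then have "\<forall>\<^sub>F n in G. e n (k n) \<le> t"
    by (intro eventually_entry_le[OF k]) (simp add: einf_supp_less_iff)
  then show "\<forall>\<^sub>F n in G. ereal (e n (k n)) < a"
    using t(2) by (auto elim!: eventually_mono intro: le_less_trans[of _ "ereal t"])
qed

lemma entries_tendsto_esup:
  assumes k: "\<forall>\<^sub>F n in G. k n \<in> {1..d n}" "((\<lambda>n. real (k n) / real (d n)) \<longlongrightarrow> 1) G"
    and le: "\<forall>\<^sub>F n in G. ereal (e n (k n)) \<le> esup (supp M)"
  shows "((\<lambda>n. ereal (e n (k n))) \<longlongrightarrow> esup (supp M)) G"
proof (rule order_tendstoI)
  fix a assume "esup (supp M) < a"
  then show "\<forall>\<^sub>F n in G. ereal (e n (k n)) < a"
    using le by (auto elim!: eventually_mono)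
next
  fix a assume "a < esup (supp M)"
  then obtain t where t: "a < ereal t" "ereal t < esup (supp M)"
    using ereal_dense2 by blast
  then have "\<forall>\<^sub>F n in G. t < e n (k n)"
    by (intro eventually_entry_gt[OF k]) (simp add: less_esup_supp_iff)
  then show "\<forall>\<^sub>F n in G. a < ereal (e n (k n))"
    using t(1) by (auto elim!: eventually_mono intro: less_trans[of _ "ereal t"])
qed

end

section \<open>The law of a spectral symbol\<close>

text \<open>The push-forward of normalized Lebesgue measure on \<open>D\<close>. Multiplying by the
  indicator extends \<open>\<omega>\<close> by 0 to a Borel function on the whole space.\<close>

definition symbol_law :: "'a::euclidean_space set \<Rightarrow> ('a \<Rightarrow> real) \<Rightarrow> real measure" where
  "symbol_law D \<omega> = distr (uniform_measure lborel D) borel (\<lambda>y. indicator D y * \<omega> y)"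

text \<open>The integral condition of \<open>admissible_symbol\<close> is kept apart: the locale is
  first instantiated for the quantile function, and the condition is then carried over through the
  common law.\<close>

locale measurable_symbol =
  fixes D :: "'a::euclidean_space set" and \<omega> :: "'a \<Rightarrow> real"
  assumes D_borel [measurable]: "D \<in> sets borel"
    and D_pos: "0 < emeasure lborel D" and D_finite: "emeasure lborel D < \<infinity>"
    and \<omega>_measurable: "\<omega> \<in> borel_measurable (restrict_space borel D)"
begin

lemma ext_measurable [measurable]: "(\<lambda>y. indicator D y * \<omega> y) \<in> borel_measurable borel"
  using \<omega>_measurable by (simp add: borel_measurable_restrict_space_iff)

lemma ext_measurable_uniform [measurable]:
  "(\<lambda>y. indicator D y * \<omega> y) \<in> borel_measurable (uniform_measure lborel D)"
  using ext_measurable measurable_cong_sets[OF sets_uniform_measure refl] by simp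

lemma measure_D_pos: "0 < measure lborel D"
  using D_pos D_finite by (simp add: measure_def enn2real_positive_iff)

lemma emeasure_D: "emeasure lborel D = ennreal (measure lborel D)"
  using D_finite by (simp add: emeasure_eq_ennreal_measure)

lemma real_distribution_symbol_law: "real_distribution (symbol_law D \<omega>)"
proof -
  interpret prob_space "uniform_measure lborel D"
    using D_pos D_finite by (intro prob_space_uniform_measure) auto
  show ?thesis
    unfolding symbol_law_def by (intro real_distribution_distr) measurable
qed

lemma emeasure_symbol_law:
  assumes [measurable]: "B \<in> sets borel"
  shows "emeasure (symbol_law D \<omega>) B = emeasure lborel {y \<in> D. \<omega> y \<in> B} / emeasure lborel D"
proof -
  let ?f = "\<lambda>y. indicator D y * \<omega> y"
  have "emeasure (symbol_law D \<omega>) B = emeasure (uniform_measure lborel D) (?f -` B)"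
    unfolding symbol_law_def using emeasure_distr[OF ext_measurable_uniform assms] by simp
  also have "\<dots> = emeasure lborel (D \<inter> ?f -` B) / emeasure lborel D"
    using measurable_sets[OF ext_measurable assms] by (intro emeasure_uniform_measure) auto
  also have "D \<inter> ?f -` B = {y \<in> D. \<omega> y \<in> B}" by (auto simp: indicator_def)
  finally show ?thesis .
qed

lemma emeasure_symbol_law_pos_iff:
  "B \<in> sets borel \<Longrightarrow>
    0 < emeasure (symbol_law D \<omega>) B \<longleftrightarrow> 0 < emeasure lborel {y \<in> D. \<omega> y \<in> B}"
  using D_finite by (auto simp: emeasure_symbol_law zero_less_iff_neq_zero ennreal_divide_eq_0_iff)

lemma cdf_symbol_law: "cdf (symbol_law D \<omega>) = symbol_cdf D \<omega>"
proof
  fix t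
  have "emeasure lborel {y \<in> D. \<omega> y \<le> t} \<le> emeasure lborel D"
    by (intro emeasure_mono) auto
  then have "emeasure lborel {y \<in> D. \<omega> y \<le> t} = ennreal (measure lborel {y \<in> D. \<omega> y \<le> t})"
    using D_finite by (intro emeasure_eq_ennreal_measure) auto
  then have "emeasure (symbol_law D \<omega>) {..t} = ennreal (symbol_cdf D \<omega> t)"
    using measure_D_pos by (simp add: emeasure_symbol_law emeasure_D symbol_cdf_def divide_ennreal)
  then show "cdf (symbol_law D \<omega>) t = symbol_cdf D \<omega> t"
    by (simp add: cdf_def measure_def symbol_cdf_def)
qed

lemma ess_range_eq_supp: "ess_range D \<omega> = supp (symbol_law D \<omega>)"
proof -
  interpret real_distribution "symbol_law D \<omega>" by (rule real_distribution_symbol_law)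
  have "0 < measure (symbol_law D \<omega>) {t - \<epsilon><..<t + \<epsilon>} \<longleftrightarrow>
      0 < emeasure lborel {y \<in> D. \<bar>\<omega> y - t\<bar> < \<epsilon>}" for t \<epsilon>
  proof -
    have "{y \<in> D. \<bar>\<omega> y - t\<bar> < \<epsilon>} = {y \<in> D. \<omega> y \<in> {t - \<epsilon><..<t + \<epsilon>}}" by auto
    then show ?thesis
      using emeasure_symbol_law_pos_iff[of "{t - \<epsilon><..<t + \<epsilon>}"] by (simp add: emeasure_eq_measure)
  qed
  then show ?thesis by (simp add: ess_range_def supp_def)
qed

lemma mono_rearr_eq_quantile: "mono_rearr D \<omega> = quantile (symbol_law D \<omega>)"
  by (simp add: fun_eq_iff mono_rearr_def quantile_def ess_range_eq_supp cdf_symbol_law)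

lemma integral_symbol_law:
  fixes F :: "real \<Rightarrow> real"
  assumes [measurable]: "F \<in> borel_measurable borel"
  shows "(LINT x|symbol_law D \<omega>. F x) = (LINT y:D|lborel. F (\<omega> y)) / measure lborel D"
proof -
  let ?f = "\<lambda>y. indicator D y * \<omega> y"
  \<comment> \<open>The density is rewritten as a real function, the form in which
    \<open>integral_density\<close> turns it into a weight of a Bochner integral.\<close>
  have "indicator D y / emeasure lborel D = ennreal (indicator D y / measure lborel D)" for y
    using measure_D_pos by (simp add: emeasure_D indicator_def ennreal_1[symmetric] divide_ennreal
        del: ennreal_1)
  then have "uniform_measure lborel D = density lborel (\<lambda>y. ennreal (indicator D y / measure lborel D))"
    by (simp add: uniform_measure_def)
  then have "(LINT x|symbol_law D \<omega>. F x) =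
      (LINT y|density lborel (\<lambda>y. ennreal (indicator D y / measure lborel D)). F (?f y))"
    unfolding symbol_law_def using integral_distr[OF ext_measurable_uniform assms] by simp
  also have "\<dots> = (LINT y|lborel. (indicator D y / measure lborel D) *\<^sub>R F (?f y))"
    using measure_D_pos by (intro integral_density) auto
  \<comment> \<open>Off \<open>D\<close> the composed function has the value \<open>F 0\<close>, but
    its weight there is 0.\<close>
  also have "\<dots> = (LINT y|lborel. (indicator D y *\<^sub>R F (\<omega> y)) / measure lborel D)"
    by (intro Bochner_Integration.integral_cong) (auto simp: indicator_def)
  also have "\<dots> = (LINT y:D|lborel. F (\<omega> y)) / measure lborel D"
    by (simp add: set_lebesgue_integral_def)
  finally show ?thesis .
qed

text \<open>Applied to the positive and the negative part, this shows that existence of the integral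
  of a symbol depends only on its law.\<close>

lemma nn_integral_symbol_law_finite_iff:
  assumes [measurable]: "f \<in> borel_measurable borel"
  shows "(\<integral>\<^sup>+x. f x \<partial>symbol_law D \<omega>) < \<infinity> \<longleftrightarrow> (\<integral>\<^sup>+y\<in>D. f (\<omega> y) \<partial>lborel) < \<infinity>"
proof -
  let ?f = "\<lambda>y. indicator D y * \<omega> y"
  have "(\<integral>\<^sup>+x. f x \<partial>symbol_law D \<omega>) = (\<integral>\<^sup>+y. f (?f y) \<partial>uniform_measure lborel D)"
    unfolding symbol_law_def by (intro nn_integral_distr) auto
  also have "\<dots> = (\<integral>\<^sup>+y. f (?f y) * indicator D y \<partial>lborel) / emeasure lborel D"
    by (intro nn_integral_uniform_measure) auto
  also have "(\<integral>\<^sup>+y. f (?f y) * indicator D y \<partial>lborel) = (\<integral>\<^sup>+y\<in>D. f (\<omega> y) \<partial>lborel)"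
    by (intro nn_integral_cong) (auto simp: indicator_def)
  finally show ?thesis
    using D_pos D_finite
    by (auto simp: less_top[symmetric] ennreal_divide_eq_top_iff)
qed

text \<open>The hypothesis excludes atoms in the essential range; any other point has a
  neighbourhood of mass zero.\<close>

lemma atomless_symbol_law:
  assumes "\<forall>t \<in> ess_range D \<omega>. emeasure lborel {y \<in> D. \<omega> y = t} = 0"
  shows "atomless_distribution (symbol_law D \<omega>)"
proof -
  interpret real_distribution "symbol_law D \<omega>" by (rule real_distribution_symbol_law)
  show ?thesis
  proof
    fix t
    show "measure (symbol_law D \<omega>) {t} = 0"
    proof (cases "t \<in> ess_range D \<omega>")
      case True
      then have "emeasure (symbol_law D \<omega>) {t} = 0"
        using assms by (simp add: emeasure_symbol_law)
      then show ?thesis by (simp add: measure_def)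
    next
      case False
      then obtain \<epsilon> where \<epsilon>: "0 < \<epsilon>" "measure (symbol_law D \<omega>) {t - \<epsilon><..<t + \<epsilon>} \<le> 0"
        by (auto simp: ess_range_eq_supp supp_def not_less)
      have "measure (symbol_law D \<omega>) {t} \<le> measure (symbol_law D \<omega>) {t - \<epsilon><..<t + \<epsilon>}"
        using \<epsilon>(1) by (intro finite_measure_mono) auto
      with \<epsilon>(2) show ?thesis by (simp add: order_antisym)
    qed
  qed
qed

end

text \<open>Inverse transform sampling: the set where the quantile is at most \<open>t\<close> lies
  between \<open>{0<..<cdf M t}\<close> and \<open>{0..cdf M t}\<close>, so it has measure
  \<open>cdf M t\<close>, and a distribution function determines its law.\<close>

lemma (in atomless_distribution)
  shows measurable_symbol_quantile: "measurable_symbol {0<..<1} (quantile M)"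
    and symbol_law_quantile: "symbol_law {0<..<1} (quantile M) = M"
proof -
  have "mono_on {0<..<1} (quantile M)"
    by (intro mono_onI) (auto intro: quantile_mono)
  then have meas: "quantile M \<in> borel_measurable (restrict_space borel {0<..<1})"
    by (intro borel_measurable_mono_on_fnc)
  then show sym: "measurable_symbol {0<..<1} (quantile M)"
    by unfold_locales auto
  interpret q: measurable_symbol "{0<..<1}" "quantile M" by (rule sym)
  have "symbol_cdf {0<..<1} (quantile M) t = cdf M t" for t
  proof -
    have bounds: "0 \<le> cdf M t" "cdf M t \<le> 1"
      by (simp_all add: cdf_nonneg cdf_bounded_prob)
    have "x \<le> cdf M t" if "0 < x" "x < 1" "quantile M x \<le> t" for x
      using cdf_nondecreasing[OF that(3)] cdf_quantile that by simp
    then have sub: "{x \<in> {0<..<1}. quantile M x \<le> t} \<subseteq> {0..cdf M t}"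
      by auto
    have sup: "{0<..<cdf M t} \<subseteq> {x \<in> {0<..<1}. quantile M x \<le> t}"
    proof
      fix x assume x: "x \<in> {0<..<cdf M t}"
      then have "0 < x" "x < 1" "x < cdf M t" using bounds by auto
      then show "x \<in> {x \<in> {0<..<1}. quantile M x \<le> t}"
        using less_cdf_iff[of x t] by simp
    qed
    have "{x \<in> space (restrict_space borel {0<..<1}). quantile M x \<le> t}
        \<in> sets (restrict_space borel {0<..<1})"
      using meas by measurable
    then have sets: "{x \<in> {0<..<1}. quantile M x \<le> t} \<in> sets lborel"
      by (simp add: sets_restrict_space_iff space_restrict_space)
    have Icc: "{0..cdf M t} \<in> fmeasurable lborel"
      using fmeasurable_cbox[of 0 "cdf M t"] by simp
    have "measure lborel {x \<in> {0<..<1}. quantile M x \<le> t} \<le> measure lborel {0..cdf M t}"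
      by (rule measure_mono_fmeasurable[OF sub sets Icc])
    moreover have "measure lborel {0<..<cdf M t}
        \<le> measure lborel {x \<in> {0<..<1}. quantile M x \<le> t}"
      by (rule measure_mono_fmeasurable[OF sup _ fmeasurableI2[OF Icc sub sets]]) simp
    ultimately have "measure lborel {x \<in> {0<..<1}. quantile M x \<le> t} = cdf M t"
      using bounds by simp
    then show ?thesis by (simp add: symbol_cdf_def)
  qed
  then show "symbol_law {0<..<1} (quantile M) = M"
    by (intro cdf_unique q.real_distribution_symbol_law real_distribution_axioms)
      (simp add: fun_eq_iff q.cdf_symbol_law)
qed

section \<open>Eigenvalue enumerations\<close>

lemma size_eig_mset:
  assumes "A \<in> carrier_mat n n"
  shows "size (eig_mset A) = n"
  using degree_monic_char_poly[OF assms] by (simp add: eig_mset_def size_proots_complex)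

lemma d_minus_plus_d_plus: "d_minus A + d_plus A = size (eig_mset A)"
proof -
  have "eig_mset A = filter_mset (\<lambda>x. x < 0) (eig_mset A) + filter_mset (\<lambda>x. \<not> x < 0) (eig_mset A)"
    by (rule multiset_partition)
  from arg_cong[OF this, of size] show ?thesis
    by (simp add: d_minus_def d_plus_def not_less)
qed

lemma bij_betw_hat_index: "bij_betw (hat_index A) (signed_indices A) {1..size (eig_mset A)}"
\<comment> \<open>The inverse of \<open>hat_index\<close>: the extra 1 subtracted on the negative
  side accounts for the missing index 0.\<close>
proof (rule bij_betw_byWitness[where f' = "\<lambda>j.
    if j \<le> d_minus A then int j - int (d_minus A) - 1 else int j - int (d_minus A)"])
qed (auto simp: hat_index_def signed_indices_def d_minus_plus_d_plus[symmetric] split: if_splits)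

lemma sum_signed_eig:
  "(\<Sum>k\<in>signed_indices A. F (signed_eig A k)) = (\<Sum>j\<in>{1..size (eig_mset A)}. F (eig A j))"
  unfolding signed_eig_def by (rule sum.reindex_bij_betw[OF bij_betw_hat_index])

lemma eig_count_eq: "eig_count A t = card {j \<in> {1..size (eig_mset A)}. eig A j \<le> t}"
proof -
  have "bij_betw (hat_index A) {k \<in> signed_indices A. signed_eig A k \<le> t}
      {j \<in> {1..size (eig_mset A)}. eig A j \<le> t}"
    using bij_betw_hat_index[of A]
    by (auto simp: bij_betw_def signed_eig_def inj_on_def simp del: atLeastAtMost_iff)
  then show ?thesis
    unfolding eig_count_def by (rule bij_betw_same_card)
qed

lemma mono_on_eig: "mono_on {1..size (eig_mset A)} (eig A)"
proof (rule mono_onI)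
  fix i j assume "i \<in> {1..size (eig_mset A)}" "j \<in> {1..size (eig_mset A)}" "i \<le> j"
  moreover have "length (sorted_list_of_multiset (eig_mset A)) = size (eig_mset A)"
    by (metis mset_sorted_list_of_multiset size_mset)
  ultimately show "eig A i \<le> eig A j"
    unfolding eig_def by (intro sorted_nth_mono) auto
qed

section \<open>Large multi-indices and endpoint values of the rearrangement\<close>

lemma eventually_multi_index_pos: "\<forall>\<^sub>F n in multi_at_top. \<forall>j. 0 < n j"
proof -
  have "\<forall>\<^sub>F n :: 'd::finite \<Rightarrow> nat in multi_at_top. 0 < Min (range n)"
    unfolding multi_at_top_def
    by (rule eventually_filtercomapI[OF eventually_gt_at_top])
  then show ?thesis by eventually_elim simp
qed

lemma multi_dim_pos: "(\<forall>j. 0 < n j) \<Longrightarrow> 0 < multi_dim n"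
  by (simp add: multi_dim_def prod_pos)

lemma eventually_index_seq:
  "index_seq k \<Longrightarrow> \<forall>\<^sub>F n in multi_at_top. k n \<in> {1..multi_dim n}"
  by (rule eventually_mono[OF eventually_multi_index_pos]) (auto simp: index_seq_def)

text \<open>One-sided continuity is restated on closed half-lines so that it composes with sequences
  of ratios that may equal their limit.\<close>

lemma at_within_atMost: "at x within {..x} = at_left (x :: 'a::linorder_topology)"
  by (rule arg_cong[of "{..x} - {x}" "{..<x} - {x}", of "\<lambda>S. inf (nhds x) (principal S)",
        folded at_within_def]) auto

lemma at_within_atLeast: "at x within {x..} = at_right (x :: 'a::linorder_topology)"
  by (rule arg_cong[of "{x..} - {x}" "{x<..} - {x}", of "\<lambda>S. inf (nhds x) (principal S)",
        folded at_within_def]) auto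

text \<open>The limits of the quantile at 0 and 1 identify the endpoint values. One-sided continuity
  follows because the extension agrees with the rearrangement on the open interval.\<close>

lemma mono_rearr_ext_endpoints:
  assumes "atomless_distribution (symbol_law D \<omega>)" "measurable_symbol D \<omega>"
  shows "mono_rearr_ext D \<omega> 0 = einf (ess_range D \<omega>)"
    and "continuous (at_right 0) (mono_rearr_ext D \<omega>)"
    and "mono_rearr_ext D \<omega> 1 = esup (ess_range D \<omega>)"
    and "continuous (at_left 1) (mono_rearr_ext D \<omega>)"
proof -
  interpret symbol: measurable_symbol D \<omega> by fact
  interpret atomless_distribution "symbol_law D \<omega>" by fact
  note lim0 = quantile_tendsto_einf[folded symbol.mono_rearr_eq_quantile symbol.ess_range_eq_supp]
  note lim1 = quantile_tendsto_esup[folded symbol.mono_rearr_eq_quantile symbol.ess_range_eq_supp]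
  show ext0: "mono_rearr_ext D \<omega> 0 = einf (ess_range D \<omega>)"
    using tendsto_Lim[OF _ lim0] by (simp add: mono_rearr_ext_def)
  show ext1: "mono_rearr_ext D \<omega> 1 = esup (ess_range D \<omega>)"
    using tendsto_Lim[OF _ lim1] by (simp add: mono_rearr_ext_def)
  have "\<forall>\<^sub>F x in at_right 0. ereal (mono_rearr D \<omega> x) = mono_rearr_ext D \<omega> x"
    unfolding eventually_at_right_field by (rule exI[of _ 1]) (simp add: mono_rearr_ext_def)
  from Lim_transform_eventually[OF lim0 this]
  show "continuous (at_right 0) (mono_rearr_ext D \<omega>)"
    by (simp add: continuous_within ext0)
  have "\<forall>\<^sub>F x in at_left 1. ereal (mono_rearr D \<omega> x) = mono_rearr_ext D \<omega> x"
    unfolding eventually_at_left_field by (rule exI[of _ 0]) (simp add: mono_rearr_ext_def)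
  from Lim_transform_eventually[OF lim1 this]
  show "continuous (at_left 1) (mono_rearr_ext D \<omega>)"
    by (simp add: continuous_within ext1)
qed

(* The six conjuncts are (a), (b), (c), (d), (e) at 0 and (e) at 1. In (c), the eigenvalues eventually
   lie in a compact part of the open interval, and the formula holds for their limit L
   (case G = multi_at_top) and for any limit L along a subfilter G. *)
theorem theorem3p1:
  fixes X :: "('d::finite \<Rightarrow> nat) \<Rightarrow> complex mat"
    and D :: "'a::euclidean_space set"
    and \<omega> :: "'a \<Rightarrow> real"
  assumes "real_spectrum_seq X"
    and "has_spectral_symbol X D \<omega>"
    and "\<forall>t \<in> ess_range D \<omega>. emeasure lborel {y \<in> D. \<omega> y = t} = 0"
  shows
    "has_spectral_symbol X {0<..<1::real} (mono_rearr D \<omega>) \<and>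
    (\<forall>t. ((\<lambda>n. real (eig_count (X n) t) / real (multi_dim n)) \<longlongrightarrow> symbol_cdf D \<omega> t) multi_at_top) \<and>
    (\<forall>k x0. index_seq k \<and> 0 < x0 \<and> x0 < 1 \<and> tends_from_left (ratio k) x0 multi_at_top \<longrightarrow>
       (\<exists>a b. einf (ess_range D \<omega>) < ereal a \<and> ereal b < esup (ess_range D \<omega>) \<and>
          (\<forall>\<^sub>F n in multi_at_top. a \<le> eig (X n) (k n) \<and> eig (X n) (k n) \<le> b)) \<and>
       (\<forall>G L. G \<le> multi_at_top \<and> G \<noteq> bot \<and> ((\<lambda>n. eig (X n) (k n)) \<longlongrightarrow> L) G \<longrightarrow>
          einf (ess_range D \<omega>) < ereal L \<and> ereal L < esup (ess_range D \<omega>) \<and>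
          (mono_rearr D \<omega> \<longlongrightarrow> Sup {t \<in> ess_range D \<omega>. t < L}) (at_left x0) \<and>
          (\<not> upper_gap_edge (ess_range D \<omega>) L \<longrightarrow>
             (mono_rearr D \<omega> \<longlongrightarrow> Sup {t \<in> ess_range D \<omega>. t \<le> L}) (at_left x0)))) \<and>
    (\<forall>k x0. index_seq k \<and> 0 < x0 \<and> x0 < 1 \<and> tends_from_left (ratio k) x0 multi_at_top \<and>
       continuous (at_left x0) (mono_rearr D \<omega>) \<longrightarrow>
       ((\<lambda>n. eig (X n) (k n)) \<longlongrightarrow> mono_rearr D \<omega> x0) multi_at_top \<and>
       ((\<lambda>n. mono_rearr D \<omega> (ratio k n)) \<longlongrightarrow> mono_rearr D \<omega> x0) multi_at_top) \<and>
    (\<forall>k. index_seq k \<and> (ratio k \<longlongrightarrow> 0) multi_at_top \<and>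
       (\<forall>\<^sub>F n in multi_at_top. einf (ess_range D \<omega>) \<le> ereal (eig (X n) (k n))) \<longrightarrow>
       ((\<lambda>n. ereal (eig (X n) (k n))) \<longlongrightarrow> mono_rearr_ext D \<omega> 0) multi_at_top \<and>
       ((\<lambda>n. mono_rearr_ext D \<omega> (ratio k n)) \<longlongrightarrow> mono_rearr_ext D \<omega> 0) multi_at_top) \<and>
    (\<forall>k. index_seq k \<and> (ratio k \<longlongrightarrow> 1) multi_at_top \<and>
       (\<forall>\<^sub>F n in multi_at_top. ereal (eig (X n) (k n)) \<le> esup (ess_range D \<omega>)) \<longrightarrow>
       ((\<lambda>n. ereal (eig (X n) (k n))) \<longlongrightarrow> mono_rearr_ext D \<omega> 1) multi_at_top \<and>
       ((\<lambda>n. mono_rearr_ext D \<omega> (ratio k n)) \<longlongrightarrow> mono_rearr_ext D \<omega> 1) multi_at_top)"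
proof (intro conjI allI impI; (elim conjE)?)
  let ?M = "symbol_law D \<omega>" and ?G = "multi_at_top :: ('d \<Rightarrow> nat) filter"
  have adm: "admissible_symbol D \<omega>" using assms(2) by (simp add: has_spectral_symbol_def)
  then have sym: "measurable_symbol D \<omega>"
    unfolding admissible_symbol_def by unfold_locales auto
  interpret symbol: measurable_symbol D \<omega> by (rule sym)
  have atomless: "atomless_distribution ?M"
    using assms(3) by (rule symbol.atomless_symbol_law)
  interpret A: atomless_distribution ?M by (rule atomless)
  note eqs = symbol.ess_range_eq_supp symbol.mono_rearr_eq_quantile symbol.cdf_symbol_law[symmetric]
  note ext = mono_rearr_ext_endpoints[OF atomless sym]
  have F_borel: "F \<in> borel_measurable borel" if "F \<in> cont_compact_support" for F
    using that by (intro borel_measurable_continuous_onI) (auto simp: cont_compact_support_def)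
  have pos: "\<forall>\<^sub>F n in ?G. 0 < multi_dim n"
    by (rule eventually_mono[OF eventually_multi_index_pos multi_dim_pos])
  have size: "\<forall>\<^sub>F n in ?G. size (eig_mset (X n)) = multi_dim n"
    using eventually_multi_index_pos
    by eventually_elim (use assms(1) in \<open>simp add: real_spectrum_seq_def size_eig_mset\<close>)
  \<comment> \<open>The hypothesis on the spectral symbol is restated for the ascending eigenvalues
    and the law of \<open>\<omega>\<close>.\<close>
  interpret V: vague_equidistribution ?M ?G multi_dim "\<lambda>n. eig (X n)"
  proof
    show "\<forall>\<^sub>F n in ?G. 0 < multi_dim n" by (rule pos)
    show "\<forall>\<^sub>F n in ?G. mono_on {1..multi_dim n} (eig (X n))"
      using size by eventually_elim (metis mono_on_eig)
    fix F :: "real \<Rightarrow> real" assume F: "F \<in> cont_compact_support"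
    have "\<forall>\<^sub>F n in ?G. (\<Sum>k\<in>signed_indices (X n). F (signed_eig (X n) k)) / real (multi_dim n) =
        (\<Sum>j\<in>{1..multi_dim n}. F (eig (X n) j)) / real (multi_dim n)"
      using size by eventually_elim (simp only: sum_signed_eig)
    moreover have "((\<lambda>n. (\<Sum>k\<in>signed_indices (X n). F (signed_eig (X n) k)) / real (multi_dim n))
        \<longlongrightarrow> (LINT x|?M. F x)) ?G"
      using assms(2) F symbol.integral_symbol_law[OF F_borel[OF F]]
      by (simp add: has_spectral_symbol_def)
    ultimately show "((\<lambda>n. (\<Sum>j\<in>{1..multi_dim n}. F (eig (X n) j)) / real (multi_dim n))
        \<longlongrightarrow> (LINT x|?M. F x)) ?G"
      by (rule Lim_transform_eventually[rotated])
  qed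
  {
    \<comment> \<open>For (a): the rearrangement has the same law as \<open>\<omega>\<close>, so
      existence of the integral and all limits of test averages carry over.\<close>
    let ?Q = "quantile ?M"
    interpret q: measurable_symbol "{0<..<1}" ?Q by (rule A.measurable_symbol_quantile)
    have "admissible_symbol {0<..<1} ?Q"
      using adm q.\<omega>_measurable
        symbol.nn_integral_symbol_law_finite_iff[of ennreal]
        symbol.nn_integral_symbol_law_finite_iff[of "\<lambda>x. ennreal (- x)"]
        q.nn_integral_symbol_law_finite_iff[of ennreal]
        q.nn_integral_symbol_law_finite_iff[of "\<lambda>x. ennreal (- x)"]
      by (simp add: admissible_symbol_def A.symbol_law_quantile)
    moreover have "(LINT y:D|lborel. F (\<omega> y)) / measure lborel D =
        (LINT y:{0<..<1}|lborel. F (?Q y)) / measure lborel {0<..<1::real}"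
      if "F \<in> cont_compact_support" for F
      using symbol.integral_symbol_law[OF F_borel[OF that]] q.integral_symbol_law[OF F_borel[OF that]]
      by (simp add: A.symbol_law_quantile)
    ultimately show "has_spectral_symbol X {0<..<1::real} (mono_rearr D \<omega>)"
      using assms(2) by (simp add: has_spectral_symbol_def eqs)
  }
  {
    fix t
    have "\<forall>\<^sub>F n in ?G. real (array_count multi_dim (\<lambda>n. eig (X n)) n t) / real (multi_dim n) =
        real (eig_count (X n) t) / real (multi_dim n)"
      using size by eventually_elim (simp add: array_count_def eig_count_eq)
    then show "((\<lambda>n. real (eig_count (X n) t) / real (multi_dim n)) \<longlongrightarrow> symbol_cdf D \<omega> t) ?G"
      using V.array_count_tendsto_cdf[of t] unfolding symbol.cdf_symbol_law
      by (rule Lim_transform_eventually[rotated])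
  }
  {
    fix k x0
    assume k: "index_seq k" and x0: "0 < x0" "x0 < 1"
      and left: "tends_from_left (ratio k) x0 ?G"
    note index = eventually_index_seq[OF k]
    have ratio: "((\<lambda>n. real (k n) / real (multi_dim n)) \<longlongrightarrow> x0) ?G"
      and ratio_le: "\<forall>\<^sub>F n in ?G. ratio k n \<in> {..x0}"
      using left by (auto simp: tends_from_left_def ratio_def[abs_def])
    show "\<exists>a b. einf (ess_range D \<omega>) < ereal a \<and> ereal b < esup (ess_range D \<omega>) \<and>
        (\<forall>\<^sub>F n in ?G. a \<le> eig (X n) (k n) \<and> eig (X n) (k n) \<le> b)"
      using V.entries_eventually_in_compact[OF index ratio x0] unfolding eqs by blast
    {
      fix G L assume G: "G \<le> ?G" "G \<noteq> bot" and L: "((\<lambda>n. eig (X n) (k n)) \<longlongrightarrow> L) G"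
      have cdf: "cdf ?M L = x0"
        by (rule V.cdf_limit_point[OF index ratio G L])
      show "einf (ess_range D \<omega>) < ereal L" "ereal L < esup (ess_range D \<omega>)"
        using cdf x0 by (simp_all add: eqs(1) A.einf_supp_less_iff A.less_esup_supp_iff)
      show lim: "(mono_rearr D \<omega> \<longlongrightarrow> Sup {t \<in> ess_range D \<omega>. t < L}) (at_left x0)"
        unfolding eqs by (rule A.quantile_left_limit[OF x0 cdf])
      assume "\<not> upper_gap_edge (ess_range D \<omega>) L"
      then have "Sup {t \<in> ess_range D \<omega>. t \<le> L} = Sup {t \<in> ess_range D \<omega>. t < L}"
        by (rule Sup_below_eq_Sup_upto) (simp only: eqs A.supp_below_nonempty[OF x0 cdf] not_False_eq_True)
      then show "(mono_rearr D \<omega> \<longlongrightarrow> Sup {t \<in> ess_range D \<omega>. t \<le> L}) (at_left x0)"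
        using lim by simp
    }
    \<comment> \<open>(d) shares the index sequence and \<open>x0\<close> with (c), so both are
      proved in one block.\<close>
    assume cont: "continuous (at_left x0) (mono_rearr D \<omega>)"
    show "((\<lambda>n. eig (X n) (k n)) \<longlongrightarrow> mono_rearr D \<omega> x0) ?G"
      using V.entries_tendsto_quantile[OF index ratio x0] cont by (simp add: eqs)
    show "((\<lambda>n. mono_rearr D \<omega> (ratio k n)) \<longlongrightarrow> mono_rearr D \<omega> x0) ?G"
      using cont left ratio_le unfolding at_within_atMost[symmetric] tends_from_left_def
      by (blast intro: continuous_within_tendsto_compose)
  }
  {
    fix k assume k: "index_seq k" and ratio: "(ratio k \<longlongrightarrow> 0) ?G"
      and ge: "\<forall>\<^sub>F n in ?G. einf (ess_range D \<omega>) \<le> ereal (eig (X n) (k n))"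
    show "((\<lambda>n. ereal (eig (X n) (k n))) \<longlongrightarrow> mono_rearr_ext D \<omega> 0) ?G"
      using V.entries_tendsto_einf[OF eventually_index_seq[OF k]] ratio ge ext(1)
      by (simp add: eqs(1) ratio_def[abs_def])
    \<comment> \<open>Ratios are never negative, so convergence to 0 is automatically from the right
      and right continuity suffices.\<close>
    have "\<forall>\<^sub>F n in ?G. ratio k n \<in> {0..}" by (simp add: ratio_def)
    then show "((\<lambda>n. mono_rearr_ext D \<omega> (ratio k n)) \<longlongrightarrow> mono_rearr_ext D \<omega> 0) ?G"
      using ext(2) ratio unfolding at_within_atLeast[symmetric]
      by (blast intro: continuous_within_tendsto_compose)
  }
  {
    fix k assume k: "index_seq k" and ratio: "(ratio k \<longlongrightarrow> 1) ?G"
      and le: "\<forall>\<^sub>F n in ?G. ereal (eig (X n) (k n)) \<le> esup (ess_range D \<omega>)"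
    show "((\<lambda>n. ereal (eig (X n) (k n))) \<longlongrightarrow> mono_rearr_ext D \<omega> 1) ?G"
      using V.entries_tendsto_esup[OF eventually_index_seq[OF k]] ratio le ext(3)
      by (simp add: eqs(1) ratio_def[abs_def])
    \<comment> \<open>Indices do not exceed the dimension, so convergence to 1 is from the
      left.\<close>
    have "\<forall>\<^sub>F n in ?G. ratio k n \<in> {..1}"
      using eventually_index_seq[OF k] by eventually_elim (auto simp: ratio_def divide_le_eq)
    then show "((\<lambda>n. mono_rearr_ext D \<omega> (ratio k n)) \<longlongrightarrow> mono_rearr_ext D \<omega> 1) ?G"
      using ext(4) ratio unfolding at_within_atMost[symmetric]
      by (blast intro: continuous_within_tendsto_compose)
  }
qed

end
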